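(* Let $S$ be an $AG^{*}$-groupoid. Then $S$ is right nuclear square, i.e. $(ab)c^{2}=a(bc^{2})$ for all $a,b,c\in S$.
   Context: A groupoid is a set $S$ with a binary operation, written as juxtaposition; no associativity or commutativity is assumed, and $c^{2}$ denotes $cc$. An AG-groupoid is a groupoid $S$ satisfying the left invertive law $(ab)c=(cb)a$ for all $a,b,c\in S$. An $AG^{*}$-groupoid is an AG-groupoid satisfying $(ab)c=b(ac)$ for all $a,b,c\in S$. An AG-groupoid $S$ is right nuclear square if $(ab)c^{2}=a(bc^{2})$ for all $a,b,c\in S$. *)

theory Defs imports Main begin

text \<open>
  A groupoid here is a carrier set closed under a binary operation (a magma), not a
  category-theoretic groupoid. The carrier may be a proper subset of its type.
\<close>

locale groupoid =
  fixes S :: "'a set" and mult :: "'a \<Rightarrow> 'a \<Rightarrow> 'a" (infixl "\<cdot>" 70)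
  assumes closed: "\<lbrakk>a \<in> S; b \<in> S\<rbrakk> \<Longrightarrow> a \<cdot> b \<in> S"

locale AG_groupoid = groupoid +
  assumes left_invertive:
    "\<lbrakk>a \<in> S; b \<in> S; c \<in> S\<rbrakk> \<Longrightarrow> (a \<cdot> b) \<cdot> c = (c \<cdot> b) \<cdot> a"

locale AG_star_groupoid = AG_groupoid +
  assumes star:
    "\<lbrakk>a \<in> S; b \<in> S; c \<in> S\<rbrakk> \<Longrightarrow> (a \<cdot> b) \<cdot> c = b \<cdot> (a \<cdot> c)"

locale right_nuclear_square_AG_groupoid = AG_groupoid +
  assumes right_nuclear_square:
    "\<lbrakk>a \<in> S; b \<in> S; c \<in> S\<rbrakk> \<Longrightarrow> (a \<cdot> b) \<cdot> (c \<cdot> c) = a \<cdot> (b \<cdot> (c \<cdot> c))"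

end

theory Submission imports Defs begin

text \<open>
  The left invertive law and the star law together give \<open>a(bc) = a(cb)\<close>. By the medial law
  \<open>(ab)c\<^sup>2 = (ac)(bc)\<close>, which the star law turns into \<open>c(a(bc)) = c((bc)a)\<close>. Since
  \<open>(bc)a = (ac)b\<close>, this is symmetric in \<open>a\<close> and \<open>b\<close>; so \<open>(ab)c\<^sup>2 = (ba)c\<^sup>2 = a(bc\<^sup>2)\<close>.
\<close>

text \<open>The left invertive law, applied to the whole product, then inside it, then to the whole
  again, exchanges \<open>b\<close> and \<open>c\<close>.\<close>

lemma (in AG_groupoid) medial:
  assumes "a \<in> S" "b \<in> S" "c \<in> S" "d \<in> S"
  shows "(a \<cdot> b) \<cdot> (c \<cdot> d) = (a \<cdot> c) \<cdot> (b \<cdot> d)"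
proof -
  have "(a \<cdot> b) \<cdot> (c \<cdot> d) = ((c \<cdot> d) \<cdot> b) \<cdot> a"
    using assms by (intro left_invertive closed)
  also have "\<dots> = ((b \<cdot> d) \<cdot> c) \<cdot> a"
    using assms by (simp only: left_invertive[of c d b])
  also have "\<dots> = (a \<cdot> c) \<cdot> (b \<cdot> d)"
    using assms by (intro left_invertive closed)
  finally show ?thesis .
qed

context AG_star_groupoid
begin

text \<open>By \<open>star\<close> the two sides are \<open>(b \<cdot> a) \<cdot> c\<close> and
  \<open>(c \<cdot> a) \<cdot> b\<close>, which are left invertive images of each other.\<close>

lemma right_factor_commute:
  assumes "a \<in> S" "b \<in> S" "c \<in> S"
  shows "a \<cdot> (b \<cdot> c) = a \<cdot> (c \<cdot> b)"
  using assms star[of b a c] star[of c a b] left_invertive[of b a c] by simp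

lemma mult_square_commute:
  assumes "a \<in> S" "b \<in> S" "c \<in> S"
  shows "(a \<cdot> b) \<cdot> (c \<cdot> c) = (b \<cdot> a) \<cdot> (c \<cdot> c)"
proof -
  have "(a \<cdot> b) \<cdot> (c \<cdot> c) = (a \<cdot> c) \<cdot> (b \<cdot> c)"
    using assms by (intro medial)
  also have "\<dots> = c \<cdot> (a \<cdot> (b \<cdot> c))"
    using assms by (intro star closed)
  also have "\<dots> = c \<cdot> ((b \<cdot> c) \<cdot> a)"
    using assms by (intro right_factor_commute closed)
  also have "\<dots> = c \<cdot> ((a \<cdot> c) \<cdot> b)"
    using assms by (simp only: left_invertive[of b c a])
  \<comment> \<open>From here the first three steps are retraced backwards with \<open>a\<close> and
    \<open>b\<close> exchanged.\<close>
  also have "\<dots> = c \<cdot> (b \<cdot> (a \<cdot> c))"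
    using assms by (intro right_factor_commute closed)
  also have "\<dots> = (b \<cdot> c) \<cdot> (a \<cdot> c)"
    using assms by (intro star[symmetric] closed)
  also have "\<dots> = (b \<cdot> a) \<cdot> (c \<cdot> c)"
    using assms by (intro medial)
  finally show ?thesis .
qed

lemma right_nuclear_square:
  assumes "a \<in> S" "b \<in> S" "c \<in> S"
  shows "(a \<cdot> b) \<cdot> (c \<cdot> c) = a \<cdot> (b \<cdot> (c \<cdot> c))"
  \<comment> \<open>\<open>star\<close> moves the left factor inwards, hence the prior swap of
    \<open>a\<close> and \<open>b\<close>.\<close>
  using assms mult_square_commute[of a b c] star[of b a "c \<cdot> c"] closed by simp

end

theorem theorem13:
  fixes S :: "'a set" and mult :: "'a \<Rightarrow> 'a \<Rightarrow> 'a"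
  assumes "AG_star_groupoid S mult"
  shows "right_nuclear_square_AG_groupoid S mult"
proof -
  interpret AG_star_groupoid S mult by (fact assms)
  show ?thesis by unfold_locales (rule right_nuclear_square)
qed

end
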